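(* There exists $f\in\mathcal K_H^0$ such that $f(\mathbb D)$ is an ellipse and the harmonic self-convolution $f\mathbin{\widetilde *}f$ is not locally univalent in $\mathbb D$.
   Context: $\mathbb D=\{z\in\mathbb C:|z|<1\}$. Every complex-valued harmonic map $f$ on $\mathbb D$ can be written uniquely as $f=h+\overline g$ with $h,g$ analytic on $\mathbb D$ and $g(0)=0$. Its Jacobian is $J_f=|h'|^2-|g'|^2$, and $f$ is sense-preserving where $|h'|>|g'|$. $\mathcal K_H$ is the class of sense-preserving univalent (injective) harmonic mappings $f=h+\overline g$ of $\mathbb D$ onto convex domains, normalized by $f(0)=0$ and $h'(0)=1$. $\mathcal K_H^0$ is the subclass of those $f\in\mathcal K_H$ with $g'(0)=0$. If $f=h+\overline g$ with $h(z)=z+\sum_{n\ge2}a_nz^n$ and $g(z)=\sum_{n\ge1}b_nz^n$, the harmonic self-convolution is $$(f\mathbin{\widetilde *}f)(z)=z+\sum_{n\ge2}a_n^2z^n+\overline{\sum_{n\ge1}b_n^2z^n}.$$ "$f(\mathbb D)$ is an ellipse" means that $f(\mathbb D)$ is the bounded open region enclosed by an ellipse. A map is locally univalent in $\mathbb D$ if every point of $\mathbb D$ has a neighbourhood on which the map is injective. *)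

theory Defs
  imports "HOL-Complex_Analysis.Complex_Analysis"
begin

abbreviation unit_disk :: "complex set" ("\<D>")
  where "\<D> \<equiv> ball 0 1"

text \<open>
  A map is harmonic on an open set if it is twice continuously differentiable in the real sense
  and its Laplacian vanishes. Below \<open>p\<close>, \<open>q\<close> are the partial derivatives of \<open>f\<close> with respect to
  the real and the imaginary part of the argument, and \<open>p1\<close>, \<open>p2\<close>, \<open>q1\<close>, \<open>q2\<close> are those of \<open>p\<close>
  and \<open>q\<close>.
\<close>
definition harmonic_on :: "(complex \<Rightarrow> complex) \<Rightarrow> complex set \<Rightarrow> bool" where
  "harmonic_on f S \<longleftrightarrow>
    (\<exists>p q p1 p2 q1 q2.
      (\<forall>z\<in>S. (f has_derivative (\<lambda>w. Re w *\<^sub>R p z + Im w *\<^sub>R q z)) (at z)) \<and>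
      (\<forall>z\<in>S. (p has_derivative (\<lambda>w. Re w *\<^sub>R p1 z + Im w *\<^sub>R p2 z)) (at z)) \<and>
      (\<forall>z\<in>S. (q has_derivative (\<lambda>w. Re w *\<^sub>R q1 z + Im w *\<^sub>R q2 z)) (at z)) \<and>
      continuous_on S p1 \<and> continuous_on S p2 \<and> continuous_on S q1 \<and> continuous_on S q2 \<and>
      (\<forall>z\<in>S. p1 z + q2 z = 0))"

definition canonical_decomposition ::
    "(complex \<Rightarrow> complex) \<Rightarrow> (complex \<Rightarrow> complex) \<Rightarrow> (complex \<Rightarrow> complex) \<Rightarrow> bool" where
  "canonical_decomposition f h g \<longleftrightarrow>
    h holomorphic_on \<D> \<and> g holomorphic_on \<D> \<and> g 0 = 0 \<and> (\<forall>z\<in>\<D>. f z = h z + cnj (g z))"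

text \<open>
  Every harmonic map on the disk has a canonical decomposition, and it is unique on the disk
  (\<open>canonical_decomposition_unique\<close>); the values of the two parts outside the disk are
  irrelevant below.
\<close>
definition analytic_part :: "(complex \<Rightarrow> complex) \<Rightarrow> complex \<Rightarrow> complex" where
  "analytic_part f = (SOME h. \<exists>g. canonical_decomposition f h g)"

definition coanalytic_part :: "(complex \<Rightarrow> complex) \<Rightarrow> complex \<Rightarrow> complex" where
  "coanalytic_part f = (SOME g. \<exists>h. canonical_decomposition f h g)"

lemma real_valued_holomorphic_constant:
  assumes hol: "r holomorphic_on \<D>" and real: "\<And>w. w \<in> \<D> \<Longrightarrow> Im (r w) = 0" and "z \<in> \<D>"
  shows "r z = r 0"
proof -
  have "r constant_on \<D>"
  proof (rule ccontr)
    assume "\<not> r constant_on \<D>"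
    then have "open (r ` \<D>)"
      by (intro open_mapping_thm[OF hol]) auto
    moreover have "r 0 \<in> r ` \<D>" by simp
    ultimately obtain e where e: "e > 0" "ball (r 0) e \<subseteq> r ` \<D>"
      using open_contains_ball by blast
    have "r 0 + \<i> * of_real (e/2) \<in> ball (r 0) e"
      using e(1) by (simp add: dist_norm norm_mult)
    then obtain w where w: "w \<in> \<D>" "r w = r 0 + \<i> * of_real (e/2)"
      using e(2) by (metis (no_types, lifting) imageE subsetD)
    have "Im (r w) = 0" "Im (r 0) = 0"
      using real[OF w(1)] real[of 0] by simp_all
    with w(2) e(1) show False by simp
  qed
  then show ?thesis
    using assms(3) unfolding constant_on_def by auto
qed

lemma canonical_decomposition_unique:
  assumes "canonical_decomposition f h1 g1" "canonical_decomposition f h2 g2" "z \<in> \<D>"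
  shows "h1 z = h2 z" "g1 z = g2 z"
proof -
  define r where "r = (\<lambda>z. (h1 z - h2 z) + (g2 z - g1 z))"
  define s where "s = (\<lambda>z. \<i> * ((h1 z - h2 z) - (g2 z - g1 z)))"
  have hol: "r holomorphic_on \<D>" "s holomorphic_on \<D>"
    using assms unfolding r_def s_def canonical_decomposition_def
    by (auto intro!: holomorphic_intros)
  have eq: "h1 w - h2 w = cnj (g2 w - g1 w)" if "w \<in> \<D>" for w
  proof -
    have "h1 w + cnj (g1 w) = h2 w + cnj (g2 w)"
      using assms that unfolding canonical_decomposition_def by metis
    then show ?thesis by (simp add: algebra_simps)
  qed
  have rs: "r w = of_real (2 * Re (g2 w - g1 w))" "s w = of_real (2 * Im (g2 w - g1 w))"
    if "w \<in> \<D>" for w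
    using eq[OF that] unfolding r_def s_def by (simp_all add: complex_eq_iff)
  have const: "r z = r 0" "s z = s 0"
    by (rule real_valued_holomorphic_constant[OF _ _ assms(3)]; use hol rs in simp)+
  have "g1 0 = 0" "g2 0 = 0"
    using assms unfolding canonical_decomposition_def by auto
  then have "g2 z - g1 z = 0"
    using const rs[OF assms(3)] rs[of 0] by (simp add: complex_eq_iff)
  with eq[OF assms(3)] show "h1 z = h2 z" "g1 z = g2 z" by auto
qed

lemma canonical_parts_eq:
  assumes "canonical_decomposition f h g" "z \<in> \<D>"
  shows "analytic_part f z = h z" "coanalytic_part f z = g z"
proof -
  have "\<exists>h g. canonical_decomposition f h g"
    using assms by blast
  then have "\<exists>g. canonical_decomposition f (analytic_part f) g"
    unfolding analytic_part_def by (rule someI_ex)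
  then show "analytic_part f z = h z"
    using canonical_decomposition_unique(1) assms by blast
  have "\<exists>g h. canonical_decomposition f h g"
    using assms by blast
  then have "\<exists>h. canonical_decomposition f h (coanalytic_part f)"
    unfolding coanalytic_part_def by (rule someI_ex)
  then show "coanalytic_part f z = g z"
    using canonical_decomposition_unique(2) assms by blast
qed

lemma canonical_decomposition_imp_harmonic:
  assumes "canonical_decomposition f h g"
  shows "harmonic_on f \<D>"
proof -
  have hol: "h holomorphic_on \<D>" "g holomorphic_on \<D>" and f: "\<And>z. z \<in> \<D> \<Longrightarrow> f z = h z + cnj (g z)"
    using assms by (auto simp: canonical_decomposition_def)
  have gen: "((\<lambda>z. k z + cnj (l z)) has_derivative (\<lambda>w. Re w *\<^sub>R (deriv k z + cnj (deriv l z)) + Im w *\<^sub>R (\<i> * deriv k z - \<i> * cnj (deriv l z)))) (at z)"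
    if "k holomorphic_on \<D>" "l holomorphic_on \<D>" "z \<in> \<D>" for k l z
  proof -
    have "(k has_field_derivative deriv k z) (at z)" "(l has_field_derivative deriv l z) (at z)"
      using that holomorphic_derivI[OF _ open_ball] by blast+
    then have "(k has_derivative (\<lambda>w. deriv k z * w)) (at z)" "(l has_derivative (\<lambda>w. deriv l z * w)) (at z)"
      by (simp_all add: has_field_derivative_def)
    then have "((\<lambda>z. k z + cnj (l z)) has_derivative (\<lambda>w. deriv k z * w + cnj (deriv l z * w))) (at z)"
      by (intro has_derivative_add has_derivative_cnj)
    moreover have "(\<lambda>w. deriv k z * w + cnj (deriv l z * w)) = (\<lambda>w. Re w *\<^sub>R (deriv k z + cnj (deriv l z)) + Im w *\<^sub>R (\<i> * deriv k z - \<i> * cnj (deriv l z)))"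
      by (rule ext) (simp add: complex_eq_iff algebra_simps)
    ultimately show ?thesis by simp
  qed
  have d: "deriv h holomorphic_on \<D>" "deriv g holomorphic_on \<D>" "(deriv (deriv h)) holomorphic_on \<D>" "(deriv (deriv g)) holomorphic_on \<D>"
    using hol by (auto intro!: holomorphic_deriv)
  have di: "deriv (\<lambda>z. \<i> * deriv h z) z = \<i> * deriv (deriv h) z" "deriv (\<lambda>z. \<i> * deriv g z) z = \<i> * deriv (deriv g) z" if "z \<in> \<D>" for z
    using d that by (auto intro!: deriv_cmult holomorphic_on_imp_differentiable_at)
  show ?thesis unfolding harmonic_on_def
    apply (rule exI[of _ "\<lambda>z. deriv h z + cnj (deriv g z)"])
    apply (rule exI[of _ "\<lambda>z. \<i> * deriv h z + cnj (\<i> * deriv g z)"])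
    apply (rule exI[of _ "\<lambda>z. deriv (deriv h) z + cnj (deriv (deriv g) z)"])
    apply (rule exI[of _ "\<lambda>z. \<i> * deriv (deriv h) z - \<i> * cnj (deriv (deriv g) z)"])
    apply (rule exI[of _ "\<lambda>z. \<i> * deriv (deriv h) z - \<i> * cnj (deriv (deriv g) z)"])
    apply (rule exI[of _ "\<lambda>z. - deriv (deriv h) z - cnj (deriv (deriv g) z)"])
    apply (intro conjI ballI)
    subgoal for z
      apply (rule has_derivative_transform_within_open[where s = "\<D>"])
      using gen[OF hol, of z] f by auto
    subgoal for z using gen[OF d(1,2)] by simp
    subgoal for z
      using gen[OF holomorphic_on_mult[OF holomorphic_on_const d(1)]
          holomorphic_on_mult[OF holomorphic_on_const d(2)], of z \<i> \<i>] di[of z]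
      by (simp add: algebra_simps)
    using d(3,4)[THEN holomorphic_on_imp_continuous_on] by (auto intro!: continuous_intros)
qed

definition harmonic_jacobian :: "(complex \<Rightarrow> complex) \<Rightarrow> complex \<Rightarrow> real" where
  "harmonic_jacobian f z =
    (norm (deriv (analytic_part f) z))\<^sup>2 - (norm (deriv (coanalytic_part f) z))\<^sup>2"

definition sense_preserving :: "(complex \<Rightarrow> complex) \<Rightarrow> bool" where
  "sense_preserving f \<longleftrightarrow> (\<forall>z\<in>\<D>. harmonic_jacobian f z > 0)"

definition K_H :: "(complex \<Rightarrow> complex) set" where
  "K_H = {f. harmonic_on f \<D> \<and> sense_preserving f \<and> inj_on f \<D> \<and>
             open (f ` \<D>) \<and> connected (f ` \<D>) \<and> convex (f ` \<D>) \<and>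
             f 0 = 0 \<and> deriv (analytic_part f) 0 = 1}"

definition K_H0 :: "(complex \<Rightarrow> complex) set" where
  "K_H0 = {f \<in> K_H. deriv (coanalytic_part f) 0 = 0}"

text \<open>
  The leading summand \<open>z\<close> is the term of index 1 of the analytic part, in accordance with the
  normalization of \<open>K_H\<close>; the two series start at index 2 and at index 1.
\<close>
definition harmonic_self_convolution :: "(complex \<Rightarrow> complex) \<Rightarrow> complex \<Rightarrow> complex" where
  "harmonic_self_convolution f z =
    (let a = fps_nth (fps_expansion (analytic_part f) 0);
         b = fps_nth (fps_expansion (coanalytic_part f) 0)
     in z + (\<Sum>n. (a (n + 2))\<^sup>2 * z ^ (n + 2)) + cnj (\<Sum>n. (b (n + 1))\<^sup>2 * z ^ (n + 1)))"

text \<open>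
  The open region bounded by the ellipse with centre \<open>c\<close>, semi-axes \<open>a\<close> and \<open>b\<close>, and axis
  directions \<open>u\<close> and \<open>\<i> * u\<close>. A circle counts as an ellipse.
\<close>
definition elliptic_region :: "complex set \<Rightarrow> bool" where
  "elliptic_region E \<longleftrightarrow>
    (\<exists>c u a b. norm u = 1 \<and> a > 0 \<and> b > 0 \<and>
      E = {c + u * Complex x y |x y. (x / a)\<^sup>2 + (y / b)\<^sup>2 < 1})"

definition locally_univalent_on :: "(complex \<Rightarrow> complex) \<Rightarrow> complex set \<Rightarrow> bool" where
  "locally_univalent_on F S \<longleftrightarrow>
    (\<forall>z\<in>S. \<exists>U. open U \<and> z \<in> U \<and> U \<subseteq> S \<and> inj_on F U)"

end

theory Submission
  imports Defs
begin

text \<open>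
  The harmonic extension of the boundary map \<open>z \<mapsto> M(z)\<^sup>2 / z\<close>, where \<open>M(z) = (3 z + 1) / (3 + z)\<close>, is
  an explicit rational harmonic homeomorphism of the disk onto itself (\<open>1/3\<close> is the
  largest modulus of the zero of \<open>M\<close> for which the circle map is monotone). Injectivity and positivity of
  the Jacobian follow from a single inequality. Precomposing with a Moebius automorphism and
  postcomposing with a real linear map that restores \<open>g'(0) = 0\<close> gives a map onto an ellipse whose
  coefficients are real combinations of \<open>(9 n + 1) (-1/2)\<^sup>n\<close> and \<open>(-1/5)\<^sup>n\<close>. Its self-convolution
  is therefore real on the real axis, where it turns out not to be monotone near \<open>-1\<close>; at an
  interior minimum of this restriction it cannot be locally injective.
\<close>

section \<open>A harmonic self-map of the disk: injectivity\<close>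

text \<open>The boundary map \<open>M(z)^2 / z\<close> has residue \<open>1/9\<close> at
  \<open>0\<close>, and \<open>1 / z = cnj z\<close> on the circle. That pole therefore extends to
  \<open>cnj z / 9\<close>, and the remaining partial fractions, analytic in the disk, form
  \<open>disk_h\<close>.\<close>

definition disk_h :: "complex \<Rightarrow> complex" where
  "disk_h z = 16 * (5 * z + 3) / (9 * (3 + z)\<^sup>2)"

definition disk_map :: "complex \<Rightarrow> complex" where
  "disk_map z = disk_h z + cnj z / 9"

lemma three_plus_nonzero: "norm z \<le> 1 \<Longrightarrow> 3 + z \<noteq> (0::complex)"
  by (metis add.commute add_eq_0_iff2 norm_minus_cancel norm_numeral not_le numeral_le_one_iff
      semiring_norm(70))

lemma disk_h_diff:
  assumes "3 + z \<noteq> 0" "3 + w \<noteq> 0"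
  shows "disk_h z - disk_h w
    = 16 / 9 * (z - w) * (27 - 3 * (z + w) - 5 * z * w) / ((3 + z)\<^sup>2 * (3 + w)\<^sup>2)"
  using assms unfolding disk_h_def
  by (simp add: divide_simps) (simp add: power2_eq_square algebra_simps)

text \<open>For \<open>z \<noteq> w\<close> this says that the difference quotient of
  \<open>disk_h\<close> exceeds \<open>1/9\<close> in modulus, which gives injectivity; for
  \<open>z = w\<close> it says the same of the derivative, which gives a positive Jacobian. Both
  sides are compared with functions of \<open>s = Re z + Re w\<close>: the left by the inequality of
  the means, the right through its real part.\<close>

lemma disk_h_key_inequality:
  fixes z w :: complex
  assumes "norm z < 1" "norm w < 1"
  shows "(norm (3 + z))\<^sup>2 * (norm (3 + w))\<^sup>2 < 16 * norm (27 - 3 * (z + w) - 5 * z * w)"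
proof -
  define s where "s = Re z + Re w"
  have sq: "(norm (3 + u))\<^sup>2 < 10 + 6 * Re u" if "norm u < 1" for u
  proof -
    have "(norm u)\<^sup>2 < 1" using that by (simp add: abs_square_less_1)
    then show ?thesis by (simp add: cmod_power2) (simp add: power2_eq_square algebra_simps)
  qed
  have "\<bar>Re z\<bar> < 1" "\<bar>Re w\<bar> < 1"
    using abs_Re_le_cmod[of z] abs_Re_le_cmod[of w] assms by linarith+
  then have s: "-2 < s" "s < 2" unfolding s_def by linarith+
  have "norm (z * w) < 1"
    using mult_strict_mono[OF assms] by (simp add: norm_mult)
  then have re: "Re (z * w) < 1"
    using complex_Re_le_cmod[of "z * w"] by linarith
  define p q where "p = (norm (3 + z))\<^sup>2" and "q = (norm (3 + w))\<^sup>2"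
  have pq: "p \<ge> 0" "q \<ge> 0" "p + q < 20 + 6 * s"
    using sq[OF assms(1)] sq[OF assms(2)] unfolding p_def q_def s_def by simp_all
  have "4 * (p * q) \<le> (p + q)\<^sup>2"
    using zero_le_power2[of "p - q"] by (simp add: power2_eq_square algebra_simps)
  also have "\<dots> < (20 + 6 * s)\<^sup>2"
    using pq by (intro power_strict_mono) auto
  \<comment> \<open>The right side minus the left is \<open>36 * (2 - s) * (s + 14)\<close>.\<close>
  also have "\<dots> \<le> 4 * (16 * (22 - 3 * s))"
    using mult_nonneg_nonneg[of "2 - s" "s + 14"] s by (simp add: power2_eq_square algebra_simps)
  finally have "p * q < 16 * (22 - 3 * s)" by simp
  moreover have "22 - 3 * s < Re (27 - 3 * (z + w) - 5 * (z * w))"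
    using re unfolding s_def by simp
  moreover have "\<dots> \<le> norm (27 - 3 * (z + w) - 5 * (z * w))"
    by (rule complex_Re_le_cmod)
  ultimately show ?thesis unfolding p_def q_def by (simp add: mult.assoc)
qed

text \<open>Equal values would force the difference quotient of \<open>disk_h\<close> to have
  modulus exactly \<open>1/9\<close>.\<close>

lemma inj_on_disk_map: "inj_on disk_map \<D>"
proof (rule inj_onI, rule ccontr)
  fix z w assume zw: "z \<in> \<D>" "w \<in> \<D>" and eq: "disk_map z = disk_map w" and "z \<noteq> w"
  have n: "norm z < 1" "norm w < 1" using zw by auto
  then have nz: "3 + z \<noteq> 0" "3 + w \<noteq> 0" by (simp_all add: three_plus_nonzero)
  have "disk_h z - disk_h w = - cnj (z - w) / 9"
    using eq by (simp add: disk_map_def algebra_simps diff_divide_distrib)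
  then have "norm (disk_h z - disk_h w) = norm (z - w) / 9"
    by (metis complex_mod_cnj norm_divide norm_minus_cancel norm_numeral)
  moreover have "norm (disk_h z - disk_h w) = 16 / 9 * norm (z - w) *
      norm (27 - 3 * (z + w) - 5 * z * w) / ((norm (3 + z))\<^sup>2 * (norm (3 + w))\<^sup>2)"
    unfolding disk_h_diff[OF nz] by (simp only: norm_mult norm_divide norm_power) simp
  ultimately have "16 * norm (27 - 3 * (z + w) - 5 * z * w) = (norm (3 + z))\<^sup>2 * (norm (3 + w))\<^sup>2"
    using nz \<open>z \<noteq> w\<close> by (simp add: divide_simps)
  with \<open>z \<noteq> w\<close> disk_h_key_inequality[OF n] show False by simp
qed

section \<open>Surjectivity onto the disk\<close>

text \<open>The circle is mapped into itself, so \<open>1 - (norm z)^2\<close> must divide the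
  deficit. In real coordinates the claim is a polynomial identity.\<close>

lemma disk_map_norm_deficit:
  assumes "3 + z \<noteq> 0"
  shows "1 - (norm (disk_map z))\<^sup>2 = (1 - (norm z)\<^sup>2) *
    (36 * (Re z)\<^sup>2 + 12 * (17 + (norm z)\<^sup>2) * Re z + 4257 + 98 * (norm z)\<^sup>2 + (norm z) ^ 4)
    / (81 * (norm (3 + z)) ^ 4)"
proof -
  define x y where "x = Re z" and "y = Im z"
  have z: "z = Complex x y" by (simp add: x_def y_def)
  have "disk_map z = (16 * (5 * z + 3) + cnj z * (3 + z)\<^sup>2) / (9 * (3 + z)\<^sup>2)"
    using assms by (simp add: disk_map_def disk_h_def field_simps)
  then have "(norm (disk_map z))\<^sup>2
      = (norm (16 * (5 * z + 3) + cnj z * (3 + z)\<^sup>2))\<^sup>2 / (81 * (norm (3 + z)) ^ 4)"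
    by (simp add: norm_divide norm_mult norm_power power_divide power_mult_distrib flip: power_mult)
  moreover have "81 * (norm (3 + z)) ^ 4 - (norm (16 * (5 * z + 3) + cnj z * (3 + z)\<^sup>2))\<^sup>2
     = (1 - (norm z)\<^sup>2) *
    (36 * x\<^sup>2 + 12 * (17 + (norm z)\<^sup>2) * x + 4257 + 98 * (norm z)\<^sup>2 + (norm z) ^ 4)"
  proof -
    have four: "(norm u) ^ 4 = ((Re u)\<^sup>2 + (Im u)\<^sup>2)\<^sup>2" for u
      by (simp flip: cmod_power2 power_mult)
    show ?thesis
      unfolding four cmod_power2 z
      by (simp add: power2_eq_square) algebra
  qed
  ultimately show ?thesis
    using assms by (simp add: x_def field_simps)
qed

text \<open>The cofactor of \<open>1 - (norm z)^2\<close> in the deficit is positive on the closed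
  disk. Boundary points are included so that their images are known to miss the open disk.\<close>

lemma norm_disk_map_less_1_iff:
  assumes "norm z \<le> 1"
  shows "norm (disk_map z) < 1 \<longleftrightarrow> norm z < 1"
proof -
  have nz: "3 + z \<noteq> 0" using assms by (rule three_plus_nonzero)
  define K where "K = 36 * (Re z)\<^sup>2 + 12 * (17 + (norm z)\<^sup>2) * Re z + 4257 + 98 * (norm z)\<^sup>2 + (norm z) ^ 4"
  have R: "(norm z)\<^sup>2 \<le> 1" using assms by (simp add: abs_square_le_1)
  have "-1 \<le> Re z" using abs_Re_le_cmod[of z] assms by linarith
  then have "- (17 + (norm z)\<^sup>2) \<le> (17 + (norm z)\<^sup>2) * Re z"
    using mult_left_mono[of "-1" "Re z" "17 + (norm z)\<^sup>2"] by simp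
  \<comment> \<open>This is the only summand of \<open>K\<close> that can be negative, and the
    constant \<open>4257\<close> outweighs it.\<close>
  then have "12 * (17 + (norm z)\<^sup>2) * Re z \<ge> - 216" using R by linarith
  moreover have "36 * (Re z)\<^sup>2 + 98 * (norm z)\<^sup>2 + (norm z) ^ 4 \<ge> 0" by simp
  ultimately have K: "K > 0" unfolding K_def by linarith
  define c where "c = K / (81 * (norm (3 + z)) ^ 4)"
  have c: "c > 0" using K nz by (simp add: c_def)
  have eq: "1 - (norm (disk_map z))\<^sup>2 = (1 - (norm z)\<^sup>2) * c"
    using disk_map_norm_deficit[OF nz] by (simp add: K_def c_def)
  have lt: "norm u < 1 \<longleftrightarrow> 0 < 1 - (norm u)\<^sup>2" for u :: complex
    by (simp add: abs_square_less_1)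
  show "norm (disk_map z) < 1 \<longleftrightarrow> norm z < 1"
    unfolding lt eq using c by (simp add: zero_less_mult_iff)
qed

lemma continuous_on_disk_map: "continuous_on (cball 0 1) disk_map"
  unfolding disk_map_def disk_h_def
  by (intro continuous_intros) (auto simp: three_plus_nonzero)

text \<open>The image is open by invariance of domain. It is also closed in the disk, being the
  trace there of the compact image of the closed disk, so connectedness makes it everything.\<close>

lemma disk_map_image: "disk_map ` \<D> = \<D>"
proof -
  have sub: "disk_map ` \<D> \<subseteq> \<D>" using norm_disk_map_less_1_iff by (auto simp: less_imp_le)
  have "disk_map ` \<D> = \<D> \<inter> disk_map ` cball 0 1"
    using sub norm_disk_map_less_1_iff by fastforce
  moreover have "closed (disk_map ` cball 0 1)"
    by (intro compact_imp_closed compact_continuous_image continuous_on_disk_map) auto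
  ultimately have "closedin (top_of_set \<D>) (disk_map ` \<D>)"
    by (metis closedin_closed_Int)
  moreover have "open (disk_map ` \<D>)"
    by (rule invariance_of_domain[OF continuous_on_subset[OF continuous_on_disk_map] _ inj_on_disk_map])
       auto
  then have "openin (top_of_set \<D>) (disk_map ` \<D>)"
    using sub by (simp add: open_subset)
  moreover have "connected \<D>" by simp
  ultimately show ?thesis
    unfolding connected_clopen by blast
qed

section \<open>Derivatives, Moebius shift and linear normalization\<close>

text \<open>The numerator is left unsimplified to match \<open>disk_h_key_inequality\<close> at
  \<open>w = z\<close>.\<close>

lemma disk_h_has_derivative:
  assumes "norm z < 1"
  shows "(disk_h has_field_derivative 16 / 9 * (27 - 3 * (z + z) - 5 * z * z) / (3 + z) ^ 4) (at z)"
proof -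
  have "3 + z \<noteq> 0" using assms by (simp add: three_plus_nonzero)
  then show ?thesis
    unfolding disk_h_def
    by (auto intro!: derivative_eq_intros simp: divide_simps) (simp add: power_def algebra_simps)
qed

text \<open>
  The base point \<open>shift 0 = 1/5\<close> is chosen so that the pole \<open>-3\<close> of \<open>disk_h\<close> is pulled back to \<open>-2\<close>.
\<close>
definition shift :: "complex \<Rightarrow> complex" where
  "shift z = (5 * z + 1) / (5 + z)"

lemma shift_bij_betw: "bij_betw shift \<D> \<D>"
proof -
  have nz: "5 + z \<noteq> 0" "5 - z \<noteq> 0" if "norm z < 1" for z :: complex
    using that norm_minus_cancel[of z] by (auto simp: add_eq_0_iff2 simp del: norm_minus_cancel)
  have in1: "norm ((5 * z + 1) / (5 + z)) < 1" and in2: "norm ((5 * z - 1) / (5 - z)) < 1"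
    if "norm z < 1" for z :: complex
  proof -
    have R: "(norm z)\<^sup>2 < 1" using that by (simp add: abs_square_less_1)
    have "(norm (5 * z + 1))\<^sup>2 < (norm (5 + z))\<^sup>2" "(norm (5 * z - 1))\<^sup>2 < (norm (5 - z))\<^sup>2"
      using R by (simp_all add: cmod_power2) (simp_all add: power2_eq_square algebra_simps)
    then have "norm (5 * z + 1) < norm (5 + z)" "norm (5 * z - 1) < norm (5 - z)"
      by (simp_all add: power_less_imp_less_base)
    then show "norm ((5 * z + 1) / (5 + z)) < 1" "norm ((5 * z - 1) / (5 - z)) < 1"
      using nz[OF that] by (simp_all add: norm_divide)
  qed
  show ?thesis
  proof (rule bij_betw_byWitness[where f' = "\<lambda>z. (5 * z - 1) / (5 - z)"])
    show "\<forall>z\<in>\<D>. (5 * shift z - 1) / (5 - shift z) = z"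
      using nz in1 by (auto simp: shift_def divide_simps)
    show "\<forall>z\<in>\<D>. shift ((5 * z - 1) / (5 - z)) = z"
      using nz in2 by (auto simp: shift_def divide_simps)
    show "shift ` \<D> \<subseteq> \<D>" using in1 by (auto simp: shift_def)
    show "(\<lambda>z. (5 * z - 1) / (5 - z)) ` \<D> \<subseteq> \<D>" using in2 by auto
  qed
qed

lemma shift_has_derivative:
  assumes "norm z < 1"
  shows "(shift has_field_derivative 24 / (5 + z)\<^sup>2) (at z)"
proof -
  have "5 + z \<noteq> 0"
    using assms norm_minus_cancel[of z] by (auto simp: add_eq_0_iff2 simp del: norm_minus_cancel)
  then show ?thesis
    unfolding shift_def
    by (auto intro!: derivative_eq_intros simp: divide_simps power2_eq_square algebra_simps)
qed

text \<open>
  The stretchings \<open>300/157\<close> of the real and \<open>100/31\<close> of the imaginary part have half-sum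
  \<open>12500/4867\<close> and half-difference \<open>-3200/4867\<close>; they are forced by \<open>h'(0) = 1\<close> and \<open>g'(0) = 0\<close>.
\<close>
definition part_h :: "complex \<Rightarrow> complex" where
  "part_h z = 12500 / 4867 * (disk_h (shift z) - disk_h (shift 0))
     - 3200 / 4867 * ((shift z - shift 0) / 9)"

definition part_g :: "complex \<Rightarrow> complex" where
  "part_g z = 12500 / 4867 * ((shift z - shift 0) / 9)
     - 3200 / 4867 * (disk_h (shift z) - disk_h (shift 0))"

definition ellipse_map :: "complex \<Rightarrow> complex" where
  "ellipse_map z = part_h z + cnj (part_g z)"

text \<open>Stretching the two axes is \<open>w \<mapsto> A * w + B * cnj w\<close>, with
  \<open>A\<close> and \<open>B\<close> the half-sum and half-difference of the factors. Sorting its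
  composition with \<open>disk_map\<close> into analytic and conjugated terms gives
  \<open>part_h\<close> and \<open>part_g\<close>.\<close>

lemma ellipse_map_eq:
  "ellipse_map z = Complex (300 / 157 * Re (disk_map (shift z) - disk_map (shift 0)))
                           (100 / 31 * Im (disk_map (shift z) - disk_map (shift 0)))"
  unfolding ellipse_map_def part_h_def part_g_def disk_map_def
  by (simp add: complex_eq_iff) (simp add: field_simps)

lemma norm_shift_less_1: "norm z < 1 \<Longrightarrow> norm (shift z) < 1"
  using bij_betw_imp_surj_on[OF shift_bij_betw] by (metis image_eqI mem_ball_0)

lemma part_derivatives:
  assumes "norm z < 1"
  defines "d \<equiv> 16 / 9 * (27 - 3 * (shift z + shift z) - 5 * shift z * shift z) / (3 + shift z) ^ 4"
    and "s \<equiv> 24 / (5 + z)\<^sup>2"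
  shows "(part_h has_field_derivative (12500 / 4867 * d - 3200 / 4867 / 9) * s) (at z)"
    and "(part_g has_field_derivative (12500 / 4867 / 9 - 3200 / 4867 * d) * s) (at z)"
proof -
  have d: "((\<lambda>z. disk_h (shift z)) has_field_derivative d * s) (at z)"
    unfolding d_def s_def using assms(1)
    by (intro DERIV_chain2[OF disk_h_has_derivative shift_has_derivative] norm_shift_less_1)
  have s: "(shift has_field_derivative s) (at z)"
    unfolding s_def by (rule shift_has_derivative[OF assms(1)])
  have "(part_h has_field_derivative 12500 / 4867 * (d * s - 0) - 3200 / 4867 * ((s - 0) / 9)) (at z)"
    unfolding part_h_def by (intro DERIV_diff DERIV_cmult DERIV_cdivide DERIV_const d s)
  then show "(part_h has_field_derivative (12500 / 4867 * d - 3200 / 4867 / 9) * s) (at z)"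
    by (simp add: left_diff_distrib mult.assoc)
  have "(part_g has_field_derivative 12500 / 4867 * ((s - 0) / 9) - 3200 / 4867 * (d * s - 0)) (at z)"
    unfolding part_g_def by (intro DERIV_diff DERIV_cmult DERIV_cdivide DERIV_const d s)
  then show "(part_g has_field_derivative (12500 / 4867 / 9 - 3200 / 4867 * d) * s) (at z)"
    by (simp add: left_diff_distrib mult.assoc)
qed

lemma canonical_decomposition_ellipse_map: "canonical_decomposition ellipse_map part_h part_g"
proof -
  have "part_h holomorphic_on \<D>"
    unfolding holomorphic_on_open[OF open_ball] by (metis mem_ball_0 part_derivatives(1))
  moreover have "part_g holomorphic_on \<D>"
    unfolding holomorphic_on_open[OF open_ball] by (metis mem_ball_0 part_derivatives(2))
  ultimately show ?thesis
    by (simp add: canonical_decomposition_def ellipse_map_def part_g_def)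
qed

text \<open>The canonical parts are choices determined only on the disk, so equality is transferred
  through a neighbourhood of \<open>z\<close>.\<close>

lemma deriv_parts:
  assumes "norm z < 1"
  shows "deriv (analytic_part ellipse_map) z = deriv part_h z"
    and "deriv (coanalytic_part ellipse_map) z = deriv part_g z"
proof -
  have "eventually (\<lambda>w. w \<in> \<D>) (nhds z)"
    using assms by (intro eventually_nhds_in_open) auto
  then have "eventually (\<lambda>w. analytic_part ellipse_map w = part_h w) (nhds z)"
    and "eventually (\<lambda>w. coanalytic_part ellipse_map w = part_g w) (nhds z)"
    by (eventually_elim, simp add: canonical_parts_eq[OF canonical_decomposition_ellipse_map])+
  then show "deriv (analytic_part ellipse_map) z = deriv part_h z"
    and "deriv (coanalytic_part ellipse_map) z = deriv part_g z"
    by (auto intro: deriv_cong_ev)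
qed

text \<open>Postcomposition with a real linear map multiplies the Jacobian by its determinant, here
  \<open>p^2 - q^2\<close>.\<close>

lemma norm_square_diff_real_combination:
  fixes d e :: complex
  shows "(norm (of_real p * d - of_real q * e))\<^sup>2 - (norm (of_real p * e - of_real q * d))\<^sup>2
    = (p\<^sup>2 - q\<^sup>2) * ((norm d)\<^sup>2 - (norm e)\<^sup>2)"
  unfolding cmod_power2 by (simp add: power2_eq_square algebra_simps)

lemma sense_preserving_ellipse_map: "sense_preserving ellipse_map"
  unfolding sense_preserving_def harmonic_jacobian_def
proof
  fix z assume "z \<in> \<D>"
  then have z: "norm z < 1" by simp
  define d where "d = 16 / 9 * (27 - 3 * (shift z + shift z) - 5 * shift z * shift z) / (3 + shift z) ^ 4"
  define s where "s = 24 / (5 + z)\<^sup>2"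
  have w: "norm (shift z) < 1" by (rule norm_shift_less_1[OF z])
  have "5 + z \<noteq> 0"
    using z norm_minus_cancel[of z] by (auto simp: add_eq_0_iff2 simp del: norm_minus_cancel)
  then have s: "norm s > 0" by (simp add: s_def)
  have "3 + shift z \<noteq> 0" using w by (simp add: three_plus_nonzero)
  then have "norm (3 + shift z) ^ 4 > 0" by simp
  moreover have "norm (3 + shift z) ^ 4
      < 16 * norm (27 - 3 * (shift z + shift z) - 5 * shift z * shift z)"
    using disk_h_key_inequality[OF w w] by (simp flip: power_add)
  ultimately have "norm d > 1 / 9"
    unfolding d_def norm_divide norm_mult norm_power by (simp add: field_simps)
  then have "(norm d)\<^sup>2 > (1 / 9)\<^sup>2"
    by (intro power_strict_mono) auto
  \<comment> \<open>The factor \<open>30000 / 4867\<close> is the determinant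
    \<open>300/157 * 100/31\<close>.\<close>
  moreover have "(norm (12500 / 4867 * d - 3200 / 4867 / 9))\<^sup>2 - (norm (12500 / 4867 / 9 - 3200 / 4867 * d))\<^sup>2
      = 30000 / 4867 * ((norm d)\<^sup>2 - (1 / 9)\<^sup>2)"
    using norm_square_diff_real_combination[of "12500 / 4867" d "3200 / 4867" "1 / 9"]
    by (simp add: power_divide)
  ultimately have "(norm (12500 / 4867 * d - 3200 / 4867 / 9))\<^sup>2
      - (norm (12500 / 4867 / 9 - 3200 / 4867 * d))\<^sup>2 > 0"
    by simp
  then have "(norm s)\<^sup>2 * ((norm (12500 / 4867 * d - 3200 / 4867 / 9))\<^sup>2
      - (norm (12500 / 4867 / 9 - 3200 / 4867 * d))\<^sup>2) > 0"
    using s by simp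
  moreover have "deriv part_h z = (12500 / 4867 * d - 3200 / 4867 / 9) * s"
    and "deriv part_g z = (12500 / 4867 / 9 - 3200 / 4867 * d) * s"
    unfolding s_def d_def by (rule part_derivatives[OF z, THEN DERIV_imp_deriv])+
  moreover have "(norm (u * s))\<^sup>2 - (norm (v * s))\<^sup>2 = (norm s)\<^sup>2 * ((norm u)\<^sup>2 - (norm v)\<^sup>2)" for u v
    by (simp add: norm_mult power_mult_distrib algebra_simps)
  ultimately show "0 < (norm (deriv (analytic_part ellipse_map) z))\<^sup>2
      - (norm (deriv (coanalytic_part ellipse_map) z))\<^sup>2"
    unfolding deriv_parts[OF z] by metis
qed

section \<open>Elliptic image and membership in the class\<close>

text \<open>Viewing the region as an affine image of the disk gives its convexity and identifies the
  image of \<open>ellipse_map\<close>.\<close>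

lemma ellipse_eq_image:
  assumes "a > 0" "b > 0"
  shows "{c + u * Complex x y |x y. (x / a)\<^sup>2 + (y / b)\<^sup>2 < 1}
    = (\<lambda>w. c + u * Complex (a * Re w) (b * Im w)) ` \<D>" (is "?E = ?l ` \<D>")
proof (intro equalityI subsetI)
  fix v assume "v \<in> ?E"
  then obtain x y where v: "v = c + u * Complex x y" and xy: "(x / a)\<^sup>2 + (y / b)\<^sup>2 < 1"
    by blast
  have "norm (Complex (x / a) (y / b)) < 1" using xy by (simp add: complex_norm)
  moreover have "v = ?l (Complex (x / a) (y / b))" using v assms by simp
  ultimately show "v \<in> ?l ` \<D>"
    by (intro image_eqI[where x = "Complex (x / a) (y / b)"]) simp_all
next
  fix v assume "v \<in> ?l ` \<D>"
  then obtain w where w: "norm w < 1" "v = ?l w" by auto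
  then have "(norm w)\<^sup>2 < 1" by (simp add: abs_square_less_1)
  then have "(a * Re w / a)\<^sup>2 + (b * Im w / b)\<^sup>2 < 1" using assms by (simp add: cmod_power2)
  with w(2) show "v \<in> ?E"
    by (intro CollectI exI[of _ "a * Re w"] exI[of _ "b * Im w"] conjI)
qed

lemma convex_elliptic_region:
  assumes "elliptic_region E"
  shows "convex E"
proof -
  from assms obtain c u a b where ab: "a > 0" "b > 0"
    and E: "E = {c + u * Complex x y |x y. (x / a)\<^sup>2 + (y / b)\<^sup>2 < 1}"
    unfolding elliptic_region_def by blast
  have "linear (\<lambda>w. u * Complex (a * Re w) (b * Im w))"
    by (rule linearI) (simp_all add: complex_eq_iff algebra_simps)
  then have "convex ((+) c ` (\<lambda>w. u * Complex (a * Re w) (b * Im w)) ` \<D>)"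
    by (intro convex_translation convex_linear_image) auto
  then show ?thesis
    unfolding E ellipse_eq_image[OF ab] by (simp add: image_image)
qed

lemma elliptic_region_ellipse_map: "elliptic_region (ellipse_map ` \<D>)"
proof -
  define c where "c = disk_map (shift 0)"
  \<comment> \<open>Since \<open>c\<close> is real, the stretching merely multiplies it by
    \<open>300/157\<close>.\<close>
  have "Im c = 0"
    by (simp add: c_def disk_map_def disk_h_def shift_def power2_eq_square)
  then have eq: "ellipse_map z = - (300 / 157) * c + 1 * Complex (300 / 157 * Re (disk_map (shift z)))
      (100 / 31 * Im (disk_map (shift z)))" for z
    unfolding ellipse_map_eq c_def[symmetric] by (simp add: complex_eq_iff field_simps)
  have "(\<lambda>z. disk_map (shift z)) ` \<D> = \<D>"
    using disk_map_image bij_betw_imp_surj_on[OF shift_bij_betw] by (metis image_image)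
  moreover have "ellipse_map ` \<D>
      = (\<lambda>w. - (300 / 157) * c + 1 * Complex (300 / 157 * Re w) (100 / 31 * Im w)) `
        (\<lambda>z. disk_map (shift z)) ` \<D>"
    unfolding image_image eq by (rule refl)
  ultimately have "ellipse_map ` \<D>
      = (\<lambda>w. - (300 / 157) * c + 1 * Complex (300 / 157 * Re w) (100 / 31 * Im w)) ` \<D>"
    by simp
  also have "\<dots> = {- (300 / 157) * c + 1 * Complex x y |x y.
     (x / (300 / 157))\<^sup>2 + (y / (100 / 31))\<^sup>2 < 1}"
    by (rule ellipse_eq_image[symmetric]) auto
  finally show ?thesis
    unfolding elliptic_region_def
    by (intro exI[of _ "- (300 / 157) * c"] exI[of _ "1 :: complex"] exI[of _ "300 / 157 :: real"]
        exI[of _ "100 / 31 :: real"]) simp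
qed

lemma inj_on_ellipse_map: "inj_on ellipse_map \<D>"
proof (rule inj_onI)
  fix z w assume zw: "z \<in> \<D>" "w \<in> \<D>" "ellipse_map z = ellipse_map w"
  then have "disk_map (shift z) = disk_map (shift w)"
    unfolding ellipse_map_eq by (simp add: complex_eq_iff)
  then have "shift z = shift w"
    by (rule inj_onD[OF inj_on_disk_map]) (use zw norm_shift_less_1 in auto)
  then show "z = w"
    by (rule inj_onD[OF bij_betw_imp_inj_on[OF shift_bij_betw]]) (use zw in auto)
qed

lemma ellipse_map_in_K_H0: "ellipse_map \<in> K_H0"
proof -
  have "continuous_on \<D> ellipse_map"
    unfolding ellipse_map_def using canonical_decomposition_ellipse_map
    by (intro continuous_intros) (auto simp: canonical_decomposition_def holomorphic_on_imp_continuous_on)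
  then have "open (ellipse_map ` \<D>)"
    by (rule invariance_of_domain[OF _ _ inj_on_ellipse_map]) simp
  moreover have "convex (ellipse_map ` \<D>)"
    by (rule convex_elliptic_region[OF elliptic_region_ellipse_map])
  moreover have "ellipse_map 0 = 0"
    by (simp add: ellipse_map_def part_h_def part_g_def)
  moreover have "deriv (analytic_part ellipse_map) 0 = 1" "deriv (coanalytic_part ellipse_map) 0 = 0"
    using part_derivatives[of 0, THEN DERIV_imp_deriv] by (simp_all add: deriv_parts shift_def power_def)
  ultimately show ?thesis
    unfolding K_H0_def K_H_def
    using canonical_decomposition_imp_harmonic[OF canonical_decomposition_ellipse_map]
      sense_preserving_ellipse_map inj_on_ellipse_map convex_connected by blast
qed

section \<open>Power series of the two parts\<close>

lemma second_geometric_deriv_sums: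
  fixes z :: "'a :: {real_normed_field, banach}"
  assumes "norm z < 1"
  shows "(\<lambda>n. of_nat ((n + 1) * (n + 2)) * z ^ n) sums (2 / (1 - z) ^ 3)"
proof -
  have "(\<lambda>n. diffs (\<lambda>n. of_nat (Suc n)) n * z ^ n) sums (2 / (1 - z) ^ 3)"
  proof (rule termdiffs_sums_strong)
    show "((\<lambda>z. 1 / (1 - z)\<^sup>2) has_field_derivative 2 / (1 - z) ^ 3) (at z)"
      using assms by (auto intro!: derivative_eq_intros simp: divide_simps power_def)
  qed (use assms geometric_deriv_sums in auto)
  then show ?thesis by (simp add: diffs_def algebra_simps)
qed

lemma linear_coefficient_sums:
  fixes z :: "'a :: {real_normed_field, banach}"
  assumes "norm z < 1"
  shows "(\<lambda>n. of_nat (9 * n + 1) * z ^ n) sums (9 / (1 - z)\<^sup>2 - 8 / (1 - z))"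
  using sums_diff[OF sums_mult[OF geometric_deriv_sums[OF assms], of 9]
      sums_mult[OF geometric_sums[OF assms], of 8]]
  by (simp add: algebra_simps)

text \<open>Expand \<open>(9 n + 1)^2 = 81 (n + 1)(n + 2) - 225 (n + 1) + 64\<close> and sum the
  geometric series and its first two derivatives.\<close>

lemma linear_coefficient_square_sums:
  fixes z :: "'a :: {real_normed_field, banach}"
  assumes "norm z < 1"
  shows "(\<lambda>n. (of_nat (9 * n + 1))\<^sup>2 * z ^ n) sums
    (162 / (1 - z) ^ 3 - 225 / (1 - z)\<^sup>2 + 64 / (1 - z))"
  using sums_add[OF sums_diff[OF sums_mult[OF second_geometric_deriv_sums[OF assms], of 81]
      sums_mult[OF geometric_deriv_sums[OF assms], of 225]]
      sums_mult[OF geometric_sums[OF assms], of 64]]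
  by (simp add: algebra_simps power2_eq_square)

text \<open>The first term comes from the double pole at \<open>-2\<close>, the pulled-back pole of
  \<open>disk_h\<close>; the second from the simple pole of \<open>shift\<close> at
  \<open>-5\<close>.\<close>

definition coefficient :: "real \<Rightarrow> real \<Rightarrow> nat \<Rightarrow> real" where
  "coefficient p q n = p * real (9 * n + 1) * (- 1 / 2) ^ n + q * (- 1 / 5) ^ n"

lemma coefficient_sums:
  fixes z :: complex
  assumes "norm z < 1"
  shows "(\<lambda>n. of_real (coefficient p q n) * z ^ n) sums
    (of_real p * (9 / (1 + z / 2)\<^sup>2 - 8 / (1 + z / 2)) + of_real q / (1 + z / 5))"
proof -
  have "norm (- z / 2) < 1" "norm (- z / 5) < 1"
    using assms by (simp_all add: norm_divide)
  from sums_add[OF sums_mult[OF linear_coefficient_sums[OF this(1)], of "of_real p"]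
      sums_mult[OF geometric_sums[OF this(2)], of "of_real q"]]
  have "(\<lambda>n. of_real p * (of_nat (9 * n + 1) * (- z / 2) ^ n) + of_real q * (- z / 5) ^ n) sums
    (of_real p * (9 / (1 + z / 2)\<^sup>2 - 8 / (1 + z / 2)) + of_real q / (1 + z / 5))"
    by simp
  moreover have "of_real (coefficient p q n) * z ^ n =
      of_real p * (of_nat (9 * n + 1) * (- z / 2) ^ n) + of_real q * (- z / 5) ^ n" for n
  proof -
    have "(- z / 2) ^ n = (- 1 / 2) ^ n * z ^ n" "(- z / 5) ^ n = (- 1 / 5) ^ n * z ^ n"
      by (simp_all flip: power_mult_distrib)
    then show ?thesis
      by (simp only: coefficient_def of_real_add of_real_mult of_real_power) (simp add: algebra_simps)
  qed
  ultimately show ?thesis by simp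
qed

text \<open>Closed form of the series of squared coefficients: the pairwise products of the ratios
  \<open>-1/2\<close> and \<open>-1/5\<close> are \<open>1/4\<close>, \<open>1/10\<close> and
  \<open>1/25\<close>.\<close>

definition square_series :: "real \<Rightarrow> real \<Rightarrow> real \<Rightarrow> real" where
  "square_series p q x =
     p\<^sup>2 * (162 / (1 - x / 4) ^ 3 - 225 / (1 - x / 4)\<^sup>2 + 64 / (1 - x / 4))
   + 2 * p * q * (9 / (1 - x / 10)\<^sup>2 - 8 / (1 - x / 10)) + q\<^sup>2 * (1 / (1 - x / 25))"

lemma coefficient_square_sums:
  assumes "\<bar>x\<bar> < 1"
  shows "(\<lambda>n. (coefficient p q n)\<^sup>2 * x ^ n) sums square_series p q x"
proof -
  have "norm (x / 4) < 1" "norm (x / 10) < 1" "norm (x / 25) < 1"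
    using assms by simp_all
  from sums_add[OF sums_add[OF sums_mult[OF linear_coefficient_square_sums[OF this(1)], of "p\<^sup>2"]
      sums_mult[OF linear_coefficient_sums[OF this(2)], of "2 * p * q"]]
      sums_mult[OF geometric_sums[OF this(3)], of "q\<^sup>2"]]
  have "(\<lambda>n. p\<^sup>2 * ((of_nat (9 * n + 1))\<^sup>2 * (x / 4) ^ n) + 2 * p * q * (of_nat (9 * n + 1) * (x / 10) ^ n)
      + q\<^sup>2 * (x / 25) ^ n) sums square_series p q x"
    unfolding square_series_def .
  moreover have "(coefficient p q n)\<^sup>2 * x ^ n = p\<^sup>2 * ((of_nat (9 * n + 1))\<^sup>2 * (x / 4) ^ n)
      + 2 * p * q * (of_nat (9 * n + 1) * (x / 10) ^ n) + q\<^sup>2 * (x / 25) ^ n" for n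
  proof -
    define r s where "r = (- 1 / 2 :: real) ^ n" and "s = (- 1 / 5 :: real) ^ n"
    have "(x / 4) ^ n = r * r * x ^ n" "(x / 10) ^ n = r * s * x ^ n" "(x / 25) ^ n = s * s * x ^ n"
      unfolding r_def s_def by (simp_all flip: power_mult_distrib)
    then show ?thesis
      unfolding coefficient_def r_def[symmetric] s_def[symmetric]
      by (simp add: power2_eq_square algebra_simps)
  qed
  ultimately show ?thesis by simp
qed

abbreviation "coefficient_h \<equiv> coefficient (- 3125 / 14601) (5120 / 14601)"
abbreviation "coefficient_g \<equiv> coefficient (800 / 14601) (- 20000 / 14601)"

text \<open>Partial fractions in \<open>r\<close> and \<open>s\<close>. Both parts vanish at
  \<open>0\<close> while the coefficient formula has a nonzero constant term, hence the added
  coefficient of index 0.\<close>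

lemma part_sums:
  assumes "norm z < 1"
  shows "(\<lambda>n. of_real (coefficient_h n) * z ^ n) sums (part_h z + of_real (coefficient_h 0))"
    and "(\<lambda>n. of_real (coefficient_g n) * z ^ n) sums (part_g z + of_real (coefficient_g 0))"
proof -
  have nz: "2 + z \<noteq> 0" "5 + z \<noteq> 0"
    using assms norm_minus_cancel[of z] by (auto simp: add_eq_0_iff2 simp del: norm_minus_cancel)
  define r s where "r = 1 / (1 + z / 2)" and "s = 1 / (1 + z / 5)"
  have r: "r = 2 / (2 + z)" and s: "s = 5 / (5 + z)"
    using nz by (simp_all add: r_def s_def field_simps)
  have sh: "shift z = 5 - 24 / 5 * s"
    unfolding s shift_def using nz by (simp add: divide_simps)
  have shift_sum: "3 + shift z = 8 * ((2 + z) / (5 + z))" "5 * shift z + 3 = 4 * ((7 * z + 5) / (5 + z))"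
    unfolding shift_def using nz by (simp_all add: field_simps)
  have "16 * (4 * (u / w)) / (9 * (8 * (v / w))\<^sup>2) = u * w / (9 * v\<^sup>2)"
    if "v \<noteq> 0" "w \<noteq> 0" for u v w :: complex
    using that by (simp add: field_simps power2_eq_square)
  then have "disk_h (shift z) = (7 * z + 5) * (5 + z) / (9 * (2 + z)\<^sup>2)"
    unfolding disk_h_def shift_sum using nz by blast
  also have "\<dots> = 7 / 9 - 1 / 12 * (9 * r\<^sup>2 - 8 * r)"
  proof -
    \<comment> \<open>With \<open>v = 2 + z\<close> one has \<open>7 * z + 5 = 7 * v - 9\<close> and
      \<open>5 + z = v + 3\<close>.\<close>
    have "(7 * v - 9) * (v + 3) / (9 * v\<^sup>2) = 7 / 9 - 1 / 12 * (9 * (2 / v)\<^sup>2 - 8 * (2 / v))"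
      if "v \<noteq> 0" for v :: complex
      using that by (simp add: field_simps power2_eq_square)
    from this[OF nz(1)] show ?thesis unfolding r by (simp add: algebra_simps)
  qed
  finally have dh: "disk_h (shift z) = 7 / 9 - 1 / 12 * (9 * r\<^sup>2 - 8 * r)" .
  have at0: "shift 0 = 1 / 5" "disk_h (shift 0) = 25 / 36"
    by (simp_all add: shift_def disk_h_def power2_eq_square)
  have rs: "9 / (1 + z / 2)\<^sup>2 = 9 * r\<^sup>2" "8 / (1 + z / 2) = 8 * r" "c / (1 + z / 5) = c * s" for c
    by (simp_all add: r_def s_def power_divide)
  have "part_h z + of_real (coefficient_h 0)
      = of_real (- 3125 / 14601) * (9 * r\<^sup>2 - 8 * r) + of_real (5120 / 14601) * s"
    unfolding part_h_def at0(2) dh unfolding at0(1) sh by (simp add: coefficient_def field_simps)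
  then show "(\<lambda>n. of_real (coefficient_h n) * z ^ n) sums (part_h z + of_real (coefficient_h 0))"
    using coefficient_sums[OF assms, of "- 3125 / 14601" "5120 / 14601"] by (simp only: rs)
  have "part_g z + of_real (coefficient_g 0)
      = of_real (800 / 14601) * (9 * r\<^sup>2 - 8 * r) + of_real (- 20000 / 14601) * s"
    unfolding part_g_def at0(2) dh unfolding at0(1) sh by (simp add: coefficient_def field_simps)
  then show "(\<lambda>n. of_real (coefficient_g n) * z ^ n) sums (part_g z + of_real (coefficient_g 0))"
    using coefficient_sums[OF assms, of "800 / 14601" "- 20000 / 14601"] by (simp only: rs)
qed

section \<open>The self-convolution on the real axis\<close>

text \<open>Adding the constant \<open>c 0\<close> affects only the coefficient of index 0, which is
  why \<open>n > 0\<close> is required.\<close>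

lemma fps_nth_expansion:
  assumes "\<And>z. z \<in> \<D> \<Longrightarrow> F z = f z"
    and "\<And>z. norm z < 1 \<Longrightarrow> (\<lambda>n. c n * z ^ n) sums (f z + c 0)" and "n > 0"
  shows "fps_nth (fps_expansion F 0) n = c n"
proof -
  have ev: "eventually (\<lambda>z. z \<in> \<D>) (nhds (0::complex))"
    by (intro eventually_nhds_in_open) auto
  have "(\<lambda>z. F z + c 0) has_fps_expansion Abs_fps c"
    using ev by (intro has_fps_expansionI, eventually_elim) (simp add: assms)
  then have "(\<lambda>z. F z + c 0 - c 0) has_fps_expansion (Abs_fps c - fps_const (c 0))"
    by (intro fps_expansion_intros)
  then have "fps_expansion F 0 = Abs_fps c - fps_const (c 0)"
    by (simp add: fps_expansion_eqI)
  with \<open>n > 0\<close> show ?thesis by simp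
qed

text \<open>The convolution has no constant terms, so the index 0 squares contained in
  \<open>square_series\<close> are subtracted.\<close>

definition real_trace :: "real \<Rightarrow> real" where
  "real_trace x = square_series (- 3125 / 14601) (5120 / 14601) x
     + square_series (800 / 14601) (- 20000 / 14601) x - (coefficient_h 0)\<^sup>2 - (coefficient_g 0)\<^sup>2"

lemma self_convolution_on_reals:
  assumes "\<bar>x\<bar> < 1"
  shows "harmonic_self_convolution ellipse_map (of_real x) = of_real (real_trace x)"
proof -
  note parts = canonical_parts_eq[OF canonical_decomposition_ellipse_map]
  have a: "fps_nth (fps_expansion (analytic_part ellipse_map) 0) (n + 2) = of_real (coefficient_h (n + 2))"
    and b: "fps_nth (fps_expansion (coanalytic_part ellipse_map) 0) (n + 1) = of_real (coefficient_g (n + 1))"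
    for n
    by (rule fps_nth_expansion[OF parts(1) part_sums(1)] fps_nth_expansion[OF parts(2) part_sums(2)];
        simp)+
  \<comment> \<open>This identifies the separate summand \<open>z\<close> of the convolution with
    the squared term of index 1.\<close>
  have 1: "coefficient_h 1 = 1" by (simp add: coefficient_def)
  have "(\<lambda>n. (coefficient_h (n + 2))\<^sup>2 * x ^ (n + 2)) sums
      (square_series (- 3125 / 14601) (5120 / 14601) x - (coefficient_h 0)\<^sup>2 - x)"
  proof -
    have "(\<Sum>i<2. (coefficient_h i)\<^sup>2 * x ^ i) = (coefficient_h 0)\<^sup>2 + x"
      using 1 by (simp add: numeral_2_eq_2)
    with sums_split_initial_segment[where n = 2, OF coefficient_square_sums[OF assms,
        where p = "- 3125 / 14601" and q = "5120 / 14601"]]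
    show ?thesis by (simp only: diff_diff_eq)
  qed
  from sums_of_real[OF this, where 'a = complex]
  have A: "(\<Sum>n. (of_real (coefficient_h (n + 2)))\<^sup>2 * complex_of_real x ^ (n + 2)) =
      of_real (square_series (- 3125 / 14601) (5120 / 14601) x - (coefficient_h 0)\<^sup>2 - x)"
    by (intro sums_unique[symmetric]) simp
  have "(\<lambda>n. (coefficient_g (n + 1))\<^sup>2 * x ^ (n + 1)) sums
      (square_series (800 / 14601) (- 20000 / 14601) x - (coefficient_g 0)\<^sup>2)"
    using sums_split_initial_segment[OF coefficient_square_sums[OF assms], of _ _ 1] by simp
  from sums_of_real[OF this, where 'a = complex]
  have B: "(\<Sum>n. (of_real (coefficient_g (n + 1)))\<^sup>2 * complex_of_real x ^ (n + 1)) =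
      of_real (square_series (800 / 14601) (- 20000 / 14601) x - (coefficient_g 0)\<^sup>2)"
    by (intro sums_unique[symmetric]) simp
  show ?thesis
    unfolding harmonic_self_convolution_def Let_def a b A B real_trace_def by simp
qed

section \<open>Failure of local univalence\<close>

text \<open>The dip at \<open>m\<close> forces a minimum inside the interval. Local injectivity
  there would make \<phi> injective and continuous on a small interval, hence strictly monotone,
  which an interior minimum excludes.\<close>

lemma not_locally_univalent_on_disk:
  fixes \<phi> :: "real \<Rightarrow> real"
  assumes F: "\<And>x. \<bar>x\<bar> < 1 \<Longrightarrow> F (of_real x) = of_real (\<phi> x)"
    and cont: "continuous_on {a..b} \<phi>"
    and ab: "-1 < a" "a < m" "m < b" "b < 1" and "\<phi> m < \<phi> a" "\<phi> m < \<phi> b"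
  shows "\<not> locally_univalent_on F \<D>"
proof
  assume lu: "locally_univalent_on F \<D>"
  obtain y where y: "y \<in> {a..b}" and min: "\<And>x. x \<in> {a..b} \<Longrightarrow> \<phi> y \<le> \<phi> x"
    using continuous_attains_inf[OF compact_Icc _ cont] ab by fastforce
  have "\<phi> y \<le> \<phi> m" using min ab by simp
  then have "y \<noteq> a" "y \<noteq> b" using assms(7,8) by auto
  with y have aby: "a < y" "y < b" by auto
  then have "complex_of_real y \<in> \<D>" using ab by auto
  then obtain U where U: "open U" "complex_of_real y \<in> U" "inj_on F U"
    using lu unfolding locally_univalent_on_def by blast
  then obtain e where e: "e > 0" "ball (complex_of_real y) e \<subseteq> U"
    using open_contains_ball by blast
  \<comment> \<open>Halving \<open>e\<close> keeps the closed interval of radius \<open>d\<close>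
    inside the open ball; the other entries keep it inside \<open>{a..b}\<close>.\<close>
  define d where "d = Min {e / 2, y - a, b - y}"
  have d: "d > 0" "d < e" "a \<le> y - d" "y + d \<le> b"
    using e(1) aby unfolding d_def by auto
  have inj: "inj_on \<phi> {y - d..y + d}"
  proof (rule inj_onI)
    fix u v assume uv: "u \<in> {y - d..y + d}" "v \<in> {y - d..y + d}" "\<phi> u = \<phi> v"
    have "w \<in> {y - d..y + d} \<Longrightarrow> of_real w \<in> U \<and> \<bar>w\<bar> < 1" for w
      using d ab e(2) by (auto simp: dist_real_def subset_iff simp flip: of_real_diff)
    with uv F U(3) show "u = v" by (metis inj_onD of_real_eq_iff)
  qed
  have "(\<phi> (y - d) < \<phi> y \<and> \<phi> y < \<phi> (y + d)) \<or> (\<phi> (y + d) < \<phi> y \<and> \<phi> y < \<phi> (y - d))"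
    using d by (intro continuous_inj_imp_mono inj continuous_on_subset[OF cont]) auto
  moreover have "\<phi> y \<le> \<phi> (y - d)" "\<phi> y \<le> \<phi> (y + d)"
    using d aby by (auto intro!: min)
  ultimately show False by linarith
qed

lemma self_convolution_not_locally_univalent:
  "\<not> locally_univalent_on (harmonic_self_convolution ellipse_map) \<D>"
proof (rule not_locally_univalent_on_disk[where \<phi> = real_trace and a = "- 99 / 100"
      and m = "- 19 / 20" and b = 0])
  show "harmonic_self_convolution ellipse_map (of_real x) = of_real (real_trace x)" if "\<bar>x\<bar> < 1" for x
    using that by (rule self_convolution_on_reals)
  show "continuous_on {- 99 / 100..0} real_trace"
    unfolding real_trace_def square_series_def by (intro continuous_intros) auto
  show "real_trace (- 19 / 20) < real_trace (- 99 / 100)" "real_trace (- 19 / 20) < real_trace 0"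
    \<comment> \<open>All three values are explicit rationals, so the dip near \<open>-1\<close> is
      checked by exact arithmetic.\<close>
    unfolding real_trace_def square_series_def by (simp_all add: power_divide)
qed auto

theorem theorem1p2:
  shows "\<exists>f \<in> K_H0. elliptic_region (f ` \<D>) \<and>
           \<not> locally_univalent_on (harmonic_self_convolution f) \<D>"
  using ellipse_map_in_K_H0 elliptic_region_ellipse_map self_convolution_not_locally_univalent
  by blast

end
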